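(* Let $(f_1^*,f_2,f_3^* )\in\Gamma_MI$ be the reduced polynomial presentation of a Markov triple $(a,b,c)$ with $0<a<b$, $0<c<b$, $6\leq b$. Then each of $f_1,f_3$ is either a $*$-Markov polynomial or a dual $*$-Markov polynomial. If $f_1,f_2,f_3$ have bi-degree vectors $(d_1,q_1),(d_2,q_2),(d_3,q_3)$, then $$(d_2,q_2)=(d_1,q_1)+(d_3,q_3).$$
   Context: A Markov triple is a triple $(a,b,c)$ of positive integers with $a^2+b^2+c^2-abc=0$. Let $A=\mathbb Z[s_1,s_2,s_3^{\pm1}]$ with the ring involution $f^*(s_1,s_2,s_3)=f\left(\frac{s_2}{s_3},\frac{s_1}{s_3},\frac1{s_3}\right)$. The $*$-Markov equation for $(a,b,c)\in A^3$ is $aa^*+bb^*+cc^*-abc=\frac{3s_1s_2-s_1^3}{s_3}$. Its initial solution is $I=(s_1,\frac{s_1}{s_3},s_1)$. The evaluation map $\mathrm{Ev}:A^3\to\mathbb Z^3$ evaluates each coordinate at $s_1=3,s_2=3,s_3=1$. The $*$-Markov group $\Gamma_M$ is the group of transformations of $A^3$ generated by: $\lambda_{i,j}:(a,b,c)\mapsto((-1)^ia,(-1)^{i+j}b,(-1)^jc)$, $i,j\in\mathbb Z/2$; $\sigma_1:(a,b,c)\mapsto(b,a,c)$ and $\sigma_2:(a,b,c)\mapsto(a,c,b)$; $\tau_1:(a,b,c)\mapsto(-a^*,c^*,b^*-ac)$ and $\tau_2:(a,b,c)\mapsto(b^*,a^*-bc,-c^* )$; $\mu_{i,j}:(a,b,c)\mapsto(s_3^ia,s_3^{-i-j}b,s_3^jc)$,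 $i,j\in\mathbb Z$. $\Gamma_MI$ is the orbit of $I$. A solution of the $*$-Markov equation written in the form $(f_1^*,f_2,f_3^* )$ is a reduced polynomial solution if each of $f_1,f_2,f_3$ is a nonconstant polynomial in $s_1,s_2,s_3$ not divisible by $s_3$; it is then a reduced polynomial presentation of the triple $\mathrm{Ev}(f_1^*,f_2,f_3^* )$. (Each Markov triple with $0<a<b$, $0<c<b$, $6\le b$ has a unique reduced polynomial presentation lying in $\Gamma_MI$.) For a polynomial $f(s_1,s_2,s_3)$, its bi-degree vector is $(d,q)$, where $d=\deg f$ is the degree with respect to weights $(1,1,1)$ of $(s_1,s_2,s_3)$ and $q=\mathrm{Deg} f$ is the degree with respect to weights $(1,2,3)$. For $f$ of degree $d=\deg f$ not divisible by $s_3$, put $\mu(f)=s_3^{d}f\left(\frac{s_2}{s_3},\frac{s_1}{s_3},\frac1{s_3}\right)$, a polynomial. A polynomial $P(s_1,s_2,s_3)$ is a $*$-Markov polynomial if $P=s_2$, or if there exists a Markov triple $(a,b,c)$ with $0<a<b$, $0<c<b$, $6\le b$ with reduced polynomial presentation $(f_1^*,f_2,f_3^* )\in\Gamma_MI$ such that $P=f_2$. A polynomial $Q(s_1,s_2,s_3)$ is a dual $*$-Markov polynomial if $Q$ is not divisible by $s_3$ and $\mu(Q)$ is a $*$-Markov polynomial. *)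

theory Defs
  imports
    "HOL-Library.Poly_Mapping"
    "HOL-Library.Product_Plus"
    "HOL-Algebra.Bij"
    "HOL-Algebra.Generated_Groups"
begin

text \<open>
  The ring \<open>A = \<int>[s\<^sub>1, s\<^sub>2, s\<^sub>3\<^sup>\<plusminus>\<^sup>1]\<close> is the monoid ring of \<open>\<nat> \<times> \<nat> \<times> \<int>\<close> over \<open>\<int>\<close>: the key
  \<open>(i, j, k)\<close> stands for the monomial \<open>s\<^sub>1\<^sup>i s\<^sub>2\<^sup>j s\<^sub>3\<^sup>k\<close>.
\<close>

type_synonym laurent = "(nat \<times> nat \<times> int) \<Rightarrow>\<^sub>0 int"

definition s1 :: laurent where "s1 = Poly_Mapping.single (1, 0, 0) 1"
definition s2 :: laurent where "s2 = Poly_Mapping.single (0, 1, 0) 1"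
definition s3_pow :: "int \<Rightarrow> laurent" where "s3_pow k = Poly_Mapping.single (0, 0, k) 1"

abbreviation s3 :: laurent where "s3 \<equiv> s3_pow 1"
abbreviation s3_inv :: laurent where "s3_inv \<equiv> s3_pow (- 1)"

text \<open>
  \<open>laurent_subst x y z w f\<close> is \<open>f(x, y, z)\<close>, where \<open>w\<close> has to be the inverse of the unit \<open>z\<close>.
\<close>

definition laurent_subst :: "'a::comm_ring_1 \<Rightarrow> 'a \<Rightarrow> 'a \<Rightarrow> 'a \<Rightarrow> laurent \<Rightarrow> 'a" where
  "laurent_subst x y z w f =
    (\<Sum>(i, j, k) \<in> Poly_Mapping.keys f. of_int (Poly_Mapping.lookup f (i, j, k)) *
      x ^ i * y ^ j * (if 0 \<le> k then z ^ nat k else w ^ nat (- k)))"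

definition star :: "laurent \<Rightarrow> laurent" where
  "star f = laurent_subst (s2 * s3_inv) (s1 * s3_inv) s3_inv s3 f"

definition ev :: "laurent \<Rightarrow> int" where
  "ev f = laurent_subst 3 3 1 1 f"

definition Ev :: "laurent \<times> laurent \<times> laurent \<Rightarrow> int \<times> int \<times> int" where
  "Ev = (\<lambda>(a, b, c). (ev a, ev b, ev c))"

definition markov_triple :: "int \<times> int \<times> int \<Rightarrow> bool" where
  "markov_triple = (\<lambda>(a, b, c). 0 < a \<and> 0 < b \<and> 0 < c \<and>
    a\<^sup>2 + b\<^sup>2 + c\<^sup>2 - a * b * c = 0)"

definition star_markov_solution :: "laurent \<times> laurent \<times> laurent \<Rightarrow> bool" where
  "star_markov_solution = (\<lambda>(a, b, c).
    a * star a + b * star b + c * star c - a * b * c = (3 * s1 * s2 - s1 ^ 3) * s3_inv)"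

definition initial_solution :: "laurent \<times> laurent \<times> laurent" where
  "initial_solution = (s1, s1 * s3_inv, s1)"

type_synonym transformation = "laurent \<times> laurent \<times> laurent \<Rightarrow> laurent \<times> laurent \<times> laurent"

text \<open>
  The indices of \<open>\<lambda>\<^sub>i\<^sub>,\<^sub>j\<close> are classes modulo 2; the sign changes only depend on the parities.
\<close>

definition sgn_map :: "nat \<Rightarrow> nat \<Rightarrow> transformation" where
  "sgn_map i j = (\<lambda>(a, b, c). ((- 1) ^ i * a, (- 1) ^ (i + j) * b, (- 1) ^ j * c))"

definition sigma1 :: transformation where "sigma1 = (\<lambda>(a, b, c). (b, a, c))"
definition sigma2 :: transformation where "sigma2 = (\<lambda>(a, b, c). (a, c, b))"

definition tau1 :: transformation where
  "tau1 = (\<lambda>(a, b, c). (- star a, star c, star b - a * c))"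
definition tau2 :: transformation where
  "tau2 = (\<lambda>(a, b, c). (star b, star a - b * c, - star c))"

definition mu_map :: "int \<Rightarrow> int \<Rightarrow> transformation" where
  "mu_map i j = (\<lambda>(a, b, c). (s3_pow i * a, s3_pow (- i - j) * b, s3_pow j * c))"

definition Gamma_M :: "transformation set" where
  "Gamma_M = generate (BijGroup UNIV)
    ({sgn_map i j | i j. True} \<union> {sigma1, sigma2} \<union> {tau1, tau2} \<union> {mu_map i j | i j. True})"

definition initial_orbit :: "(laurent \<times> laurent \<times> laurent) set" where
  "initial_orbit = {g initial_solution | g. g \<in> Gamma_M}"

text \<open>\<open>\<int>[s\<^sub>1, s\<^sub>2, s\<^sub>3]\<close> as a subset of \<open>A\<close>; divisibility by \<open>s\<^sub>3\<close> is meant in this subring.\<close>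

definition polys :: "laurent set" where
  "polys = {f. \<forall>(i, j, k) \<in> Poly_Mapping.keys f. 0 \<le> k}"

definition s3_dvd :: "laurent \<Rightarrow> bool" where
  "s3_dvd f \<longleftrightarrow> (\<exists>g \<in> polys. f = s3 * g)"

definition nonconstant :: "laurent \<Rightarrow> bool" where
  "nonconstant f \<longleftrightarrow> f \<notin> range of_int"

definition reduced_solution :: "laurent \<Rightarrow> laurent \<Rightarrow> laurent \<Rightarrow> bool" where
  "reduced_solution f1 f2 f3 \<longleftrightarrow> star_markov_solution (star f1, f2, star f3) \<and>
    (\<forall>f \<in> {f1, f2, f3}. f \<in> polys \<and> nonconstant f \<and> \<not> s3_dvd f)"

definition reduced_presentation ::
    "laurent \<Rightarrow> laurent \<Rightarrow> laurent \<Rightarrow> int \<times> int \<times> int \<Rightarrow> bool" where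
  "reduced_presentation f1 f2 f3 t \<longleftrightarrow>
    reduced_solution f1 f2 f3 \<and> Ev (star f1, f2, star f3) = t"

text \<open>Degree of a polynomial for given weights; only meaningful on nonzero elements of \<open>polys\<close>.\<close>

definition weighted_deg :: "nat \<Rightarrow> nat \<Rightarrow> nat \<Rightarrow> laurent \<Rightarrow> nat" where
  "weighted_deg w1 w2 w3 f =
    Max ((\<lambda>(i, j, k). w1 * i + w2 * j + w3 * nat k) ` Poly_Mapping.keys f)"

definition bidegree :: "laurent \<Rightarrow> nat \<times> nat" where
  "bidegree f = (weighted_deg 1 1 1 f, weighted_deg 1 2 3 f)"

definition mu_poly :: "laurent \<Rightarrow> laurent" where
  "mu_poly f = s3 ^ weighted_deg 1 1 1 f * star f"

definition star_markov_poly :: "laurent \<Rightarrow> bool" where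
  "star_markov_poly P \<longleftrightarrow> P = s2 \<or>
    (\<exists>a b c f1 f2 f3. markov_triple (a, b, c) \<and> 0 < a \<and> a < b \<and> 0 < c \<and> c < b \<and> 6 \<le> b \<and>
      reduced_presentation f1 f2 f3 (a, b, c) \<and> (star f1, f2, star f3) \<in> initial_orbit \<and>
      P = f2)"

definition dual_star_markov_poly :: "laurent \<Rightarrow> bool" where
  "dual_star_markov_poly Q \<longleftrightarrow> Q \<in> polys \<and> \<not> s3_dvd Q \<and> star_markov_poly (mu_poly Q)"

end

theory Submission
  imports Defs
begin

text \<open>
  The map \<open>(a, b, c) \<mapsto> (a\<^sup>*, ac - b\<^sup>*, c\<^sup>*)\<close> is an involution (\<open>vieta\<close>) that lifts the Vieta involution
  \<open>(a, b, c) \<mapsto> (a, ac - b, c)\<close> of the Markov equation. Up to signs and permutations it is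
  \<open>\<tau>\<^sub>1\<close> and \<open>\<tau>\<^sub>2\<close>, so the group \<open>\<Gamma>\<^sub>M\<close> is generated by it together with the sign changes, the
  permutations and the multiplications by powers of \<open>s\<^sub>3\<close>.

  Applied to \<open>(f\<^sub>1\<^sup>*, f\<^sub>3\<^sup>*, f\<^sub>2)\<close>, the involution gives \<open>(f\<^sub>1, f\<^sub>1\<^sup>* f\<^sub>2 - f\<^sub>3, f\<^sub>2\<^sup>*)\<close>. Clearing the
  denominator by \<open>s\<^sub>3\<^sup>d\<close>, where \<open>d = deg f\<^sub>1\<close>, turns this into \<open>(g\<^sub>1\<^sup>*, g\<^sub>2, g\<^sub>3\<^sup>*)\<close> with
  \<open>g\<^sub>1 = \<mu>(f\<^sub>1)\<close>, \<open>g\<^sub>2 = \<mu>(f\<^sub>1) f\<^sub>2 - s\<^sub>3\<^sup>d f\<^sub>3\<close> and \<open>g\<^sub>3 = f\<^sub>2\<close>. Starting from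
  \<open>(s\<^sub>1, s\<^sub>1\<^sup>2 - s\<^sub>2, s\<^sub>1)\<close>, which presents \<open>(3, 6, 3)\<close>, this step and the exchange of the outer
  entries generate the set \<open>tree\<close>. Both assertions of the theorem are inherited along the tree.

  \<^item> The outer entries of the child are \<open>\<mu>(f\<^sub>1)\<close> and \<open>f\<^sub>2\<close>. The second one is a \<open>*\<close>-Markov polynomial;
    and \<open>\<mu>\<close> interchanges \<open>*\<close>-Markov and dual \<open>*\<close>-Markov polynomials because it is an involution
    on the polynomials in question (\<open>tree_sides\<close>).
  \<^item> Every polynomial of the tree is homogeneous for the weights \<open>(1, 2, 3)\<close>, and one monomial
    \<open>s\<^sub>1\<^sup>m s\<^sub>2\<^sup>n\<close> of it, with coefficient 1, has the maximal degree \<open>m + n\<close> (\<open>principal_at\<close>). The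
    exponents \<open>(m, n)\<close> determine the bi-degree vector \<open>(m + n, m + 2n)\<close> linearly. They are swapped by
    \<open>\<mu>\<close> and added by multiplication, and the subtracted term \<open>s\<^sub>3\<^sup>d f\<^sub>3\<close> leaves the principal monomial
    alone since \<open>d > 0\<close>. Hence the exponents of the middle entry are always the sum of those of the
    outer ones (\<open>tree_principal\<close>).

  It remains to see that a reduced presentation in the orbit lies in the tree. The involution
  applied to the middle entry leads to the parent, applied to an outer entry it leads to a child,
  and the initial solution is the parent of the root. Therefore signs, powers of \<open>s\<^sub>3\<close> and
  permutations take the tree and the initial solution to a set that is invariant under all of
  \<open>\<Gamma>\<^sub>M\<close>, so that it is the whole orbit (\<open>orbit_normal_form\<close>). Evaluation shows that for a positive
  triple with a strict maximum in the middle the signs and the permutation are trivial, and the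
  power of \<open>s\<^sub>3\<close> is trivial because both triples are reduced (\<open>reduced_presentation_tree\<close>).
\<close>

abbreviation coeff :: "laurent \<Rightarrow> nat \<times> nat \<times> int \<Rightarrow> int" where
  "coeff \<equiv> Poly_Mapping.lookup"

section \<open>Substitution into Laurent polynomials\<close>

text \<open>
  An integer power of the unit \<open>z\<close> with inverse \<open>w\<close> is given by cases on the sign of the exponent.
  Writing the exponent as a difference of natural numbers removes the cases.
\<close>

lemma int_power_of_diff:
  fixes z w :: "'a::comm_ring_1"
  assumes "z * w = 1"
  shows "(if 0 \<le> int a - int b then z ^ nat (int a - int b) else w ^ nat (- (int a - int b)))
    = z ^ a * w ^ b"
proof (cases "b \<le> a")
  case True
  have "z ^ a * w ^ b = z ^ (a - b) * (z * w) ^ b"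
    using True by (simp add: power_mult_distrib flip: power_add mult.assoc)
  with True assms show ?thesis
    by (simp add: of_nat_diff nat_diff_distrib)
next
  case False
  have "z ^ a * w ^ b = w ^ (b - a) * (z * w) ^ a"
    using False by (simp add: power_mult_distrib mult.left_commute flip: power_add)
  with False assms show ?thesis
    by (simp add: nat_diff_distrib)
qed

lemma int_power_add:
  fixes z w :: "'a::comm_ring_1"
  assumes "z * w = 1"
  shows "(if 0 \<le> k + l then z ^ nat (k + l) else w ^ nat (- (k + l))) =
    (if 0 \<le> k then z ^ nat k else w ^ nat (- k)) * (if 0 \<le> l then z ^ nat l else w ^ nat (- l))"
proof -
  obtain a b where k: "k = int a - int b" by (rule int_diff_cases)
  obtain c d where l: "l = int c - int d" by (rule int_diff_cases)
  have kl: "k + l = int (a + c) - int (b + d)" using k l by simp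
  show ?thesis
    unfolding kl int_power_of_diff[OF assms] unfolding k l int_power_of_diff[OF assms]
    by (simp add: power_add ac_simps)
qed

lemma laurent_subst_superset:
  assumes "finite K" "Poly_Mapping.keys f \<subseteq> K"
  shows "laurent_subst x y z w f = (\<Sum>(i, j, k) \<in> K. of_int (coeff f (i, j, k)) *
      x ^ i * y ^ j * (if 0 \<le> k then z ^ nat k else w ^ nat (- k)))"
  unfolding laurent_subst_def
  by (rule sum.mono_neutral_left) (use assms in \<open>auto simp: in_keys_iff\<close>)

lemma laurent_subst_diff:
  "laurent_subst x y z w (f - g) = laurent_subst x y z w f - laurent_subst x y z w g"
proof -
  let ?K = "Poly_Mapping.keys f \<union> Poly_Mapping.keys g"
  have "Poly_Mapping.keys (f - g) \<subseteq> ?K" by (rule keys_diff)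
  then show ?thesis
    by (simp add: laurent_subst_superset[of ?K] lookup_minus sum_subtractf[symmetric]
        case_prod_beta algebra_simps)
qed

lemma laurent_subst_zero [simp]: "laurent_subst x y z w 0 = 0"
  by (simp add: laurent_subst_def)

lemma laurent_subst_monom:
  "laurent_subst x y z w (frag_of (i, j, k)) =
    x ^ i * y ^ j * (if 0 \<le> k then z ^ nat k else w ^ nat (- k))"
  by (simp add: laurent_subst_def keys_frag_of)

text \<open>
  The monomials generate the additive group of Laurent polynomials, so an additive identity
  needs to be checked on monomials only. The coefficients are integers, which is why closure under
  differences suffices.
\<close>

lemma laurent_induct [case_names zero monom diff]:
  assumes "P 0" and "\<And>i j k. P (frag_of (i, j, k))" and "\<And>f g. P f \<Longrightarrow> P g \<Longrightarrow> P (f - g)"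
  shows "P (f :: laurent)"
  by (rule frag_induction[of f UNIV]) (use assms in auto)

lemma monom_mult:
  "(frag_of (i, j, k) :: laurent) * frag_of (i', j', k') = frag_of (i + i', j + j', k + k')"
  by (simp add: mult_single)

lemma laurent_subst_mult:
  fixes z w :: "'a::comm_ring_1"
  assumes "z * w = 1"
  shows "laurent_subst x y z w (f * g) = laurent_subst x y z w f * laurent_subst x y z w g"
proof (induction f rule: laurent_induct)
  case (monom i j k)
  show ?case
  proof (induction g rule: laurent_induct)
    case (monom i' j' k')
    show ?case
      unfolding monom_mult laurent_subst_monom int_power_add[OF assms] power_add
      by (simp only: ac_simps)
  next
    case (diff f g)
    then show ?case by (simp add: right_diff_distrib laurent_subst_diff)
  qed simp
next
  case (diff f g)
  then show ?case by (simp add: left_diff_distrib laurent_subst_diff)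
qed simp

section \<open>The involution and the evaluation\<close>

lemma s3_pow_mult: "s3_pow k * s3_pow l = s3_pow (k + l)"
  by (simp add: s3_pow_def mult_single)

lemma s3_pow_mult_left: "s3_pow k * (s3_pow l * f) = s3_pow (k + l) * f"
  by (simp add: s3_pow_mult flip: mult.assoc)

lemma s3_pow_0 [simp]: "s3_pow 0 = 1"
  unfolding s3_pow_def by (metis single_one zero_prod_def)

lemma s3_pow_power: "s3_pow k ^ n = s3_pow (k * int n)"
  by (induction n) (simp_all add: s3_pow_mult algebra_simps)

lemma s1_power: "s1 ^ n = frag_of (n, 0, 0)"
  by (induction n) (simp_all add: s1_def mult_single flip: single_one zero_prod_def)

lemma s2_power: "s2 ^ n = frag_of (0, n, 0)"
  by (induction n) (simp_all add: s2_def mult_single flip: single_one zero_prod_def)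

lemma star_diff: "star (f - g) = star f - star g"
  by (simp add: star_def laurent_subst_diff)

lemma star_mult: "star (f * g) = star f * star g"
  unfolding star_def by (rule laurent_subst_mult) (simp add: s3_pow_mult)

lemma star_zero [simp]: "star 0 = 0"
  by (simp add: star_def)

text \<open>
  The involution permutes the monomials; this gives the coefficients of \<open>star f\<close> for every \<open>f\<close>.
\<close>

lemma star_monom: "star (frag_of (i, j, k)) = frag_of (j, i, - int i - int j - k)"
proof -
  have "star (frag_of (i, j, k)) = s1 ^ j * s2 ^ i * s3_pow (- int i - int j - k)"
    unfolding star_def laurent_subst_monom
    by (auto simp: power_mult_distrib s3_pow_power s3_pow_mult s3_pow_mult_left ac_simps)
  then show ?thesis
    by (simp add: s1_power s2_power s3_pow_def mult_single)
qed

lemma star_star [simp]: "star (star f) = f"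
  by (induction f rule: laurent_induct) (simp_all add: star_monom star_diff)

lemma star_uminus: "star (- f) = - star f"
  using star_diff[of 0 f] by simp

lemma star_s3_pow: "star (s3_pow k) = s3_pow (- k)"
  unfolding s3_pow_def using star_monom[of 0 0 k] by simp

lemma star_s1: "star s1 = s2 * s3_inv"
  unfolding s1_def s2_def s3_pow_def using star_monom[of 1 0 0] by (simp add: mult_single)

lemma coeff_star: "coeff (star f) (i, j, k) = coeff f (j, i, - int i - int j - k)"
  by (induction f rule: laurent_induct) (auto simp: star_monom star_diff lookup_minus)

lemma coeff_s3_pow_mult: "coeff (s3_pow l * f) (i, j, k) = coeff f (i, j, k - l)"
proof (induction f rule: laurent_induct)
  case (monom i' j' k')
  have "s3_pow l * frag_of (i', j', k') = frag_of (i', j', l + k')"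
    by (simp add: s3_pow_def mult_single)
  then show ?case by auto
next
  case (diff f g)
  then show ?case by (simp add: right_diff_distrib lookup_minus)
qed simp

lemma ev_diff: "ev (f - g) = ev f - ev g"
  by (simp add: ev_def laurent_subst_diff)

lemma ev_uminus: "ev (- f) = - ev f"
  using ev_diff[of 0 f] by (simp add: ev_def)

lemma ev_add: "ev (f + g) = ev f + ev g"
  using ev_diff[of f "- g"] by (simp add: ev_uminus)

lemma ev_mult: "ev (f * g) = ev f * ev g"
  unfolding ev_def by (rule laurent_subst_mult) simp

lemma ev_s1: "ev s1 = 3" and ev_s2: "ev s2 = 3" and ev_s3_pow: "ev (s3_pow k) = 1"
  unfolding ev_def s1_def s2_def s3_pow_def by (simp_all add: laurent_subst_monom)

text \<open>
  The point \<open>(3, 3, 1)\<close> is fixed under \<open>(s\<^sub>1, s\<^sub>2, s\<^sub>3) \<mapsto> (s\<^sub>2/s\<^sub>3, s\<^sub>1/s\<^sub>3, 1/s\<^sub>3)\<close>.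
\<close>

lemma ev_star: "ev (star f) = ev f"
proof (induction f rule: laurent_induct)
  case (monom i j k)
  show ?case unfolding star_monom by (simp add: ev_def laurent_subst_monom)
next
  case (diff f g)
  then show ?case by (simp add: star_diff ev_diff)
qed simp

section \<open>Principal monomials\<close>

text \<open>
  The two constraints on the exponents leave \<open>s\<^sub>1\<^sup>m s\<^sub>2\<^sup>n\<close> as the only possible monomial of degree
  \<open>m + n\<close> that is free of \<open>s\<^sub>3\<close>. Its coefficient 1 makes both degree bounds sharp and keeps the
  polynomial from being divisible by \<open>s\<^sub>3\<close>.
\<close>

definition principal_at :: "laurent \<Rightarrow> nat \<Rightarrow> nat \<Rightarrow> bool" where
  "principal_at f m n \<longleftrightarrow> coeff f (m, n, 0) = 1 \<and>
    (\<forall>(i, j, k) \<in> Poly_Mapping.keys f.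
      0 \<le> k \<and> int i + int j + k \<le> int m + int n \<and> int i + 2 * int j + 3 * k = int m + 2 * int n)"

lemma principal_coeff: "principal_at f m n \<Longrightarrow> coeff f (m, n, 0) = 1"
  by (simp add: principal_at_def)

lemma principal_keys:
  assumes "principal_at f m n" "coeff f (i, j, k) \<noteq> 0"
  shows "0 \<le> k" "int i + int j + k \<le> int m + int n"
    "int i + 2 * int j + 3 * k = int m + 2 * int n"
  using assms unfolding principal_at_def in_keys_iff[symmetric] by fast+

lemma principalI:
  assumes "coeff f (m, n, 0) = 1"
    and "\<And>i j k. coeff f (i, j, k) \<noteq> 0 \<Longrightarrow> 0 \<le> k \<and> int i + int j + k \<le> int m + int n \<and>
      int i + 2 * int j + 3 * k = int m + 2 * int n"
  shows "principal_at f m n"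
  using assms unfolding principal_at_def by (auto simp: in_keys_iff)

text \<open>
  For the weights \<open>(1, 1, 1)\<close> and \<open>(1, 2, 3)\<close> the principal monomial attains the maximum.
\<close>

lemma weighted_deg_principal:
  assumes "principal_at f m n" "w1 = 1" "(w2, w3) = (1, 1) \<or> (w2, w3) = (2, 3)"
  shows "weighted_deg w1 w2 w3 f = m + w2 * n"
  unfolding weighted_deg_def
proof (rule Max_eqI)
  have "(m, n, 0) \<in> Poly_Mapping.keys f"
    using principal_coeff[OF assms(1)] by (simp add: in_keys_iff)
  then show "m + w2 * n \<in> (\<lambda>(i, j, k). w1 * i + w2 * j + w3 * nat k) ` Poly_Mapping.keys f"
    by (rule rev_image_eqI) (use assms in simp)
next
  fix y assume "y \<in> (\<lambda>(i, j, k). w1 * i + w2 * j + w3 * nat k) ` Poly_Mapping.keys f"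
  then obtain i j k where "coeff f (i, j, k) \<noteq> 0" "y = w1 * i + w2 * j + w3 * nat k"
    by (auto simp: in_keys_iff)
  with principal_keys[OF assms(1), of i j k] assms(2,3) show "y \<le> m + w2 * n"
    by auto
qed simp

lemma bidegree_principal: "principal_at f m n \<Longrightarrow> bidegree f = (m + n, m + 2 * n)"
  unfolding bidegree_def by (simp add: weighted_deg_principal)

text \<open>
  A monomial \<open>s\<^sub>1\<^sup>i s\<^sub>2\<^sup>j s\<^sub>3\<^sup>k\<close> of degree at most \<open>d = m + n\<close> is sent by \<open>\<mu>\<close> to
  \<open>s\<^sub>1\<^sup>j s\<^sub>2\<^sup>i s\<^sub>3\<^bsup>d-i-j-k\<^esup>\<close>: the degree bound becomes the nonnegativity of the new exponent of
  \<open>s\<^sub>3\<close> and vice versa, and weight \<open>q\<close> becomes weight \<open>3d - q\<close>.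
\<close>

lemma principal_mu_poly:
  assumes "principal_at f m n"
  shows "principal_at (mu_poly f) n m"
proof -
  have c: "coeff (mu_poly f) (i, j, k) = coeff f (j, i, int m + int n - int i - int j - k)" for i j k
    unfolding mu_poly_def s3_pow_power coeff_s3_pow_mult coeff_star
    by (simp add: weighted_deg_principal[OF assms] algebra_simps)
  show ?thesis
  proof (rule principalI)
    show "coeff (mu_poly f) (n, m, 0) = 1"
      unfolding c using principal_coeff[OF assms] by simp
  next
    fix i j k assume "coeff (mu_poly f) (i, j, k) \<noteq> 0"
    from principal_keys[OF assms this[unfolded c]]
    show "0 \<le> k \<and> int i + int j + k \<le> int n + int m \<and>
        int i + 2 * int j + 3 * k = int n + 2 * int m"
      by auto
  qed
qed

lemma mu_poly_principal: "principal_at f m n \<Longrightarrow> mu_poly f = s3_pow (int (m + n)) * star f"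
  by (simp add: mu_poly_def s3_pow_power weighted_deg_principal)

lemma mu_poly_mu_poly:
  assumes "principal_at f m n"
  shows "mu_poly (mu_poly f) = f"
  unfolding mu_poly_principal[OF principal_mu_poly[OF assms]]
  by (simp add: mu_poly_principal[OF assms] star_mult star_s3_pow s3_pow_mult_left)

lemma mult_keysE:
  assumes "coeff (f * g) (i, j, k) \<noteq> 0"
  obtains i1 j1 k1 i2 j2 k2 where "coeff f (i1, j1, k1) \<noteq> 0" "coeff g (i2, j2, k2) \<noteq> 0"
    "i = i1 + i2" "j = j1 + j2" "k = k1 + k2"
proof -
  have "(i, j, k) \<in> {a + b | a b. a \<in> Poly_Mapping.keys f \<and> b \<in> Poly_Mapping.keys g}"
    using keys_mult[of f g] assms unfolding in_keys_iff[symmetric] by blast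
  then obtain i1 j1 k1 i2 j2 k2 where "(i1, j1, k1) \<in> Poly_Mapping.keys f"
    "(i2, j2, k2) \<in> Poly_Mapping.keys g" "(i, j, k) = (i1, j1, k1) + (i2, j2, k2)"
    by auto
  then show thesis by (intro that) (auto simp: in_keys_iff)
qed

text \<open>
  If the product of two monomials is the product of the principal monomials, both have no \<open>s\<^sub>3\<close>,
  then both have maximal degree, and then homogeneity forces them to be the principal ones.
  So there is no cancellation.
\<close>

lemma principal_mult:
  assumes f: "principal_at f m n" and g: "principal_at g m' n'"
  shows "principal_at (f * g) (m + m') (n + n')"
proof (rule principalI)
  let ?lf = "frag_of (m, n, 0) :: laurent" and ?lg = "frag_of (m', n', 0) :: laurent"
  have uniq: "(i1, j1, k1) = (m, n, 0) \<and> (i2, j2, k2) = (m', n', 0)"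
    if "coeff f (i1, j1, k1) \<noteq> 0" "coeff g (i2, j2, k2) \<noteq> 0"
      "m + m' = i1 + i2" "n + n' = j1 + j2" "0 = k1 + k2" for i1 j1 k1 i2 j2 k2
    using principal_keys[OF f that(1)] principal_keys[OF g that(2)] that(3-5) by auto
  have 1: "coeff ((f - ?lf) * g) (m + m', n + n', 0) = 0"
  proof (rule ccontr)
    assume "coeff ((f - ?lf) * g) (m + m', n + n', 0) \<noteq> 0"
    then obtain i1 j1 k1 i2 j2 k2 where *: "coeff (f - ?lf) (i1, j1, k1) \<noteq> 0"
      "coeff g (i2, j2, k2) \<noteq> 0" "m + m' = i1 + i2" "n + n' = j1 + j2" "0 = k1 + k2"
      by (rule mult_keysE)
    from *(1) principal_coeff[OF f] have "coeff f (i1, j1, k1) \<noteq> 0" "(i1, j1, k1) \<noteq> (m, n, 0)"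
      by (auto simp: lookup_minus split: if_splits)
    with uniq *(2-5) show False by blast
  qed
  have 2: "coeff (?lf * (g - ?lg)) (m + m', n + n', 0) = 0"
  proof (rule ccontr)
    assume "coeff (?lf * (g - ?lg)) (m + m', n + n', 0) \<noteq> 0"
    then obtain i1 j1 k1 i2 j2 k2 where *: "coeff ?lf (i1, j1, k1) \<noteq> 0"
      "coeff (g - ?lg) (i2, j2, k2) \<noteq> 0" "m + m' = i1 + i2" "n + n' = j1 + j2" "0 = k1 + k2"
      by (rule mult_keysE)
    from *(1) have "(i1, j1, k1) = (m, n, 0)" by (auto split: if_splits)
    with *(2-5) principal_coeff[OF g] show False by (auto simp: lookup_minus)
  qed
  \<comment> \<open>Only the last summand reaches the principal monomial of the product.\<close>
  have "f * g = (f - ?lf) * g + ?lf * (g - ?lg) + ?lf * ?lg"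
    by (simp add: algebra_simps)
  then show "coeff (f * g) (m + m', n + n', 0) = 1"
    using 1 2 by (simp add: lookup_add mult_single)
next
  fix i j k assume "coeff (f * g) (i, j, k) \<noteq> 0"
  then obtain i1 j1 k1 i2 j2 k2 where *: "coeff f (i1, j1, k1) \<noteq> 0"
      "coeff g (i2, j2, k2) \<noteq> 0" "i = i1 + i2" "j = j1 + j2" "k = k1 + k2"
    by (rule mult_keysE)
  with principal_keys[OF f *(1)] principal_keys[OF g *(2)]
  show "0 \<le> k \<and> int i + int j + k \<le> int (m + m') + int (n + n') \<and>
      int i + 2 * int j + 3 * k = int (m + m') + 2 * int (n + n')"
    by simp
qed

lemma principal_in_polys: "principal_at f m n \<Longrightarrow> f \<in> polys"
  unfolding principal_at_def polys_def by auto

lemma principal_not_s3_dvd: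
  assumes "principal_at f m n"
  shows "\<not> s3_dvd f"
proof
  assume "s3_dvd f"
  then obtain g where g: "g \<in> polys" "f = s3 * g" by (auto simp: s3_dvd_def)
  from g(2) have "coeff g (m, n, - 1) \<noteq> 0"
    using principal_coeff[OF assms] by (simp add: coeff_s3_pow_mult)
  with g(1) show False by (auto simp: polys_def simp flip: in_keys_iff)
qed

lemma principal_nonconstant:
  assumes "principal_at f m n" "0 < m + n"
  shows "nonconstant f"
proof -
  have "coeff (of_int c) (m, n, 0) = 0" for c
    using assms(2) by (auto simp: lookup_of_int zero_prod_def when_def)
  then show ?thesis
    using principal_coeff[OF assms(1)] by (auto simp: nonconstant_def)
qed

lemma principal_s1: "principal_at s1 1 0"
  by (rule principalI) (auto simp: s1_def split: if_splits)

lemma principal_root: "principal_at (s1\<^sup>2 - s2) 2 0"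
  by (rule principalI) (auto simp: s1_power s2_def lookup_minus split: if_splits)

section \<open>The tree of reduced presentations\<close>

text \<open>
  The presentations \<open>(f\<^sub>1\<^sup>*, f\<^sub>2, f\<^sub>3\<^sup>*)\<close> above \<open>(3, 6, 3)\<close>, with the stars removed. Together with \<open>swap\<close>
  the rule \<open>child\<close> lifts both steps \<open>(a, b, c) \<mapsto> (a, ab - c, b)\<close> and \<open>(a, b, c) \<mapsto> (b, bc - a, c)\<close>
  of the Markov tree.
\<close>

inductive tree :: "laurent \<Rightarrow> laurent \<Rightarrow> laurent \<Rightarrow> bool" where
  root: "tree s1 (s1\<^sup>2 - s2) s1"
| child: "tree f1 f2 f3 \<Longrightarrow>
    tree (mu_poly f1) (mu_poly f1 * f2 - s3 ^ weighted_deg 1 1 1 f1 * f3) f2"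
| swap: "tree f1 f2 f3 \<Longrightarrow> tree f3 f2 f1"

text \<open>
  For a child, \<open>\<mu>(f\<^sub>1) f\<^sub>2\<close> has the principal exponents
  \<open>(n\<^sub>1, m\<^sub>1) + (m\<^sub>1 + m\<^sub>3, n\<^sub>1 + n\<^sub>3)\<close>, which is the sum of those of the new outer entries \<open>\<mu>(f\<^sub>1)\<close> and
  \<open>f\<^sub>2\<close>. The term \<open>s\<^sub>3\<^sup>d f\<^sub>3\<close> with \<open>d = m\<^sub>1 + n\<^sub>1 > 0\<close> has the same weight, a smaller degree, and only
  monomials divisible by \<open>s\<^sub>3\<close>.
\<close>

lemma tree_principal:
  assumes "tree f1 f2 f3"
  shows "\<exists>m1 n1 m3 n3. principal_at f1 m1 n1 \<and> principal_at f3 m3 n3 \<and>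
    principal_at f2 (m1 + m3) (n1 + n3) \<and> 0 < m1 + n1 \<and> 0 < m3 + n3"
  using assms
proof induction
  case root
  show ?case
    by (rule exI[of _ 1], rule exI[of _ 0], rule exI[of _ 1], rule exI[of _ 0])
      (use principal_s1 principal_root in \<open>simp add: numeral_2_eq_2\<close>)
next
  case (child f1 f2 f3)
  then obtain m1 n1 m3 n3 where f1: "principal_at f1 m1 n1" and f3: "principal_at f3 m3 n3"
    and f2: "principal_at f2 (m1 + m3) (n1 + n3)" and pos: "0 < m1 + n1" "0 < m3 + n3" by blast
  let ?g = "mu_poly f1 * f2 - s3 ^ weighted_deg 1 1 1 f1 * f3"
  have mu: "principal_at (mu_poly f1) n1 m1" by (rule principal_mu_poly[OF f1])
  note prod = principal_mult[OF mu f2]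
  have c: "coeff ?g (i, j, k) = coeff (mu_poly f1 * f2) (i, j, k)
      - coeff f3 (i, j, k - int (m1 + n1))" for i j k
    by (simp add: lookup_minus s3_pow_power coeff_s3_pow_mult weighted_deg_principal[OF f1])
  have "principal_at ?g (n1 + (m1 + m3)) (m1 + (n1 + n3))"
  proof (rule principalI)
    have "coeff f3 (n1 + (m1 + m3), m1 + (n1 + n3), 0 - int (m1 + n1)) = 0"
      using principal_keys(1)[OF f3, of _ _ "0 - int (m1 + n1)"] pos by fastforce
    then show "coeff ?g (n1 + (m1 + m3), m1 + (n1 + n3), 0) = 1"
      unfolding c using principal_coeff[OF prod] by simp
  next
    fix i j k assume "coeff ?g (i, j, k) \<noteq> 0"
    then consider "coeff (mu_poly f1 * f2) (i, j, k) \<noteq> 0" | "coeff f3 (i, j, k - int (m1 + n1)) \<noteq> 0"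
      unfolding c by fastforce
    then show "0 \<le> k \<and> int i + int j + k \<le> int (n1 + (m1 + m3)) + int (m1 + (n1 + n3)) \<and>
        int i + 2 * int j + 3 * k = int (n1 + (m1 + m3)) + 2 * int (m1 + (n1 + n3))"
    proof cases
      case 1
      from principal_keys[OF prod this] show ?thesis by simp
    next
      case 2
      from principal_keys[OF f3 this] pos show ?thesis by simp
    qed
  qed
  with mu f2 pos show ?case
    by (intro exI[of _ n1] exI[of _ m1] exI[of _ "m1 + m3"] exI[of _ "n1 + n3"]) auto
next
  case (swap f1 f2 f3)
  then show ?case by (metis add.commute)
qed

text \<open>
  On integers the child step is \<open>(a, b, c) \<mapsto> (a, ab - c, b)\<close>, and \<open>ab - c \<ge> 3b - c > 2b\<close>: the middle
  entry stays strictly the largest.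
\<close>

lemma tree_ev:
  assumes "tree f1 f2 f3"
  shows "3 \<le> ev f1 \<and> 3 \<le> ev f3 \<and> ev f1 < ev f2 \<and> ev f3 < ev f2 \<and> 6 \<le> ev f2"
  using assms
proof induction
  case root
  show ?case by (simp add: ev_diff power2_eq_square ev_mult ev_s1 ev_s2)
next
  case (child f1 f2 f3)
  from tree_principal[OF child.hyps] obtain m n where "principal_at f1 m n" by blast
  then have f1: "ev (mu_poly f1) = ev f1" "ev (s3 ^ weighted_deg 1 1 1 f1) = 1"
    by (simp_all only: mu_poly_principal ev_mult ev_s3_pow ev_star s3_pow_power mult_1)
  have "3 * ev f2 \<le> ev f1 * ev f2" using child.IH by (intro mult_right_mono) auto
  then show ?case
    unfolding ev_diff ev_mult f1 mult_1 using child.IH by (intro conjI) linarith+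
qed auto

section \<open>The Vieta involution and the orbit\<close>

text \<open>
  This involution is more convenient than \<open>\<tau>\<^sub>1\<close> and \<open>\<tau>\<^sub>2\<close>, which combine it with sign changes and
  permutations: it commutes with signs and with the reversal of the triple.
\<close>

definition vieta :: transformation where
  "vieta = (\<lambda>(a, b, c). (star a, a * c - star b, star c))"

lemma vieta_vieta: "vieta (vieta t) = t"
  by (cases t) (simp add: vieta_def star_diff star_mult)

lemma sigma1_sigma1: "sigma1 (sigma1 t) = t"
  by (cases t) (simp add: sigma1_def)

lemma sigma2_sigma2: "sigma2 (sigma2 t) = t"
  by (cases t) (simp add: sigma2_def)

lemma sgn_map_sgn_map: "sgn_map i j (sgn_map k l t) = sgn_map (i + k) (j + l) t"
  by (cases t) (simp add: sgn_map_def power_add ac_simps)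

lemma sgn_map_even: "even i \<Longrightarrow> even j \<Longrightarrow> sgn_map i j t = t"
  by (cases t) (simp add: sgn_map_def)

lemma mu_map_mu_map: "mu_map i j (mu_map k l t) = mu_map (i + k) (j + l) t"
proof -
  have "- i - j + (- k - l) = - (i + k) - (j + l)" by simp
  then show ?thesis by (cases t) (simp only: mu_map_def s3_pow_mult_left prod.case)
qed

lemma mu_map_0: "mu_map 0 0 t = t"
  by (cases t) (simp add: mu_map_def)

lemma tau1_eq: "tau1 = sgn_map 1 1 \<circ> sigma2 \<circ> vieta"
  by (auto simp: tau1_def sgn_map_def sigma2_def vieta_def)

lemma tau2_eq: "tau2 = sgn_map 0 1 \<circ> vieta \<circ> sigma1"
  by (auto simp: tau2_def sgn_map_def sigma1_def vieta_def mult.commute)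

lemma vieta_eq: "vieta = sigma2 \<circ> sgn_map 1 1 \<circ> tau1"
  by (auto simp: tau1_eq fun_eq_iff sgn_map_sgn_map sgn_map_even sigma2_sigma2)

definition generators :: "transformation set" where
  "generators =
    {sgn_map i j | i j. True} \<union> {sigma1, sigma2} \<union> {tau1, tau2} \<union> {mu_map i j | i j. True}"

lemma Gamma_M_eq: "Gamma_M = generate (BijGroup UNIV) generators"
  by (simp add: Gamma_M_def generators_def)

lemma bij_generators:
  assumes "h \<in> generators"
  shows "bij h"
proof -
  have inv: "bij sigma1" "bij sigma2" "bij vieta"
    using sigma1_sigma1 sigma2_sigma2 vieta_vieta by (auto intro: involuntory_imp_bij)
  have sgn: "bij (sgn_map i j)" for i j
    by (rule involuntory_imp_bij) (simp add: sgn_map_sgn_map sgn_map_even)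
  have mu: "bij (mu_map i j)" for i j
    by (rule o_bij[of "mu_map (- i) (- j)"]) (auto simp: mu_map_mu_map mu_map_0)
  have "bij tau1" "bij tau2"
    unfolding tau1_eq tau2_eq by (intro bij_comp inv sgn)+
  with inv sgn mu assms show ?thesis by (auto simp: generators_def)
qed

lemma generators_subset: "generators \<subseteq> carrier (BijGroup UNIV)"
proof
  fix h assume "h \<in> generators"
  then have "bij h" by (rule bij_generators)
  then show "h \<in> carrier (BijGroup UNIV)" by (simp add: BijGroup_def Bij_def)
qed

lemma mult_Gamma_M:
  assumes "g \<in> Gamma_M" "h \<in> Gamma_M"
  shows "h \<otimes>\<^bsub>BijGroup UNIV\<^esub> g = h \<circ> g"
proof -
  have "Gamma_M \<subseteq> carrier (BijGroup UNIV)"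
    unfolding Gamma_M_eq by (rule group.generate_incl[OF group_BijGroup generators_subset])
  with assms show ?thesis by (auto simp: BijGroup_def compose_def)
qed

lemma orbit_step:
  assumes "t \<in> initial_orbit" "h \<in> generators"
  shows "h t \<in> initial_orbit"
proof -
  obtain g where g: "g \<in> Gamma_M" "t = g initial_solution"
    using assms(1) by (auto simp: initial_orbit_def)
  have h: "h \<in> Gamma_M"
    unfolding Gamma_M_eq by (rule generate.incl[OF assms(2)])
  then have "h \<circ> g \<in> Gamma_M"
    using g(1) generate.eng unfolding Gamma_M_eq by (metis Gamma_M_eq mult_Gamma_M)
  moreover have "h t = (h \<circ> g) initial_solution" using g(2) by simp
  ultimately show ?thesis unfolding initial_orbit_def by blast
qed

lemma orbit_sgn_map: "t \<in> initial_orbit \<Longrightarrow> sgn_map i j t \<in> initial_orbit"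
  and orbit_sigma1: "t \<in> initial_orbit \<Longrightarrow> sigma1 t \<in> initial_orbit"
  and orbit_sigma2: "t \<in> initial_orbit \<Longrightarrow> sigma2 t \<in> initial_orbit"
  and orbit_tau1: "t \<in> initial_orbit \<Longrightarrow> tau1 t \<in> initial_orbit"
  and orbit_mu_map: "t \<in> initial_orbit \<Longrightarrow> mu_map k l t \<in> initial_orbit"
  by (rule orbit_step; auto simp: generators_def)+

lemma orbit_vieta: "t \<in> initial_orbit \<Longrightarrow> vieta t \<in> initial_orbit"
  unfolding vieta_eq comp_apply by (intro orbit_sigma2 orbit_sgn_map orbit_tau1)

lemma initial_in_orbit: "initial_solution \<in> initial_orbit"
proof -
  have "\<one>\<^bsub>BijGroup UNIV\<^esub> = (\<lambda>x :: laurent \<times> laurent \<times> laurent. x)"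
    by (simp add: BijGroup_def restrict_def)
  then have "(\<lambda>x. x) \<in> Gamma_M"
    using generate.one[of "BijGroup UNIV" generators] by (simp only: Gamma_M_eq)
  then show ?thesis unfolding initial_orbit_def by auto
qed

text \<open>
  The maps \<open>sigma1\<close>, \<open>sigma2\<close>, \<open>vieta\<close> and the sign changes are involutions, and the inverse of \<open>mu_map i j\<close> is \<open>mu_map (- i) (- j)\<close>. So a property preserved by
  these maps is also reflected by them, hence by the inverses of all generators.
\<close>

lemma orbit_induct [consumes 1, case_names initial sgn_map sigma1 sigma2 vieta mu_map]:
  assumes "t \<in> initial_orbit"
    and init: "P initial_solution"
    and sgn: "\<And>i j t. P t \<Longrightarrow> P (sgn_map i j t)"
    and sigma1: "\<And>t. P t \<Longrightarrow> P (sigma1 t)"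
    and sigma2: "\<And>t. P t \<Longrightarrow> P (sigma2 t)"
    and vieta: "\<And>t. P t \<Longrightarrow> P (vieta t)"
    and mu: "\<And>i j t. P t \<Longrightarrow> P (mu_map i j t)"
  shows "P t"
proof -
  have i: "P (sigma1 t) \<longleftrightarrow> P t" "P (sigma2 t) \<longleftrightarrow> P t" "P (vieta t) \<longleftrightarrow> P t" for t
    using sigma1 sigma2 vieta sigma1_sigma1 sigma2_sigma2 vieta_vieta by metis+
  have s: "P (sgn_map i j t) \<longleftrightarrow> P t" for i j t
  proof
    assume "P (sgn_map i j t)"
    from sgn[OF this, of i j] show "P t" by (simp add: sgn_map_sgn_map sgn_map_even)
  qed (rule sgn)
  have m: "P (mu_map i j t) \<longleftrightarrow> P t" for i j t
  proof
    assume "P (mu_map i j t)"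
    from mu[OF this, of "- i" "- j"] show "P t" by (simp add: mu_map_mu_map mu_map_0)
  qed (rule mu)
  have gen: "P (h t) \<longleftrightarrow> P t" if "h \<in> generators" for h t
    using that by (auto simp: generators_def tau1_eq tau2_eq i s m)
  have inv: "P (g t) \<longleftrightarrow> P t" if "g \<in> Gamma_M" for g t
    using that unfolding Gamma_M_eq
  proof (induction arbitrary: t rule: generate.induct)
    case one
    show ?case by (simp add: BijGroup_def)
  next
    case (incl h)
    then show ?case by (rule gen)
  next
    case (inv h)
    have "h \<in> Bij UNIV" using inv generators_subset by (auto simp: BijGroup_def)
    then have "inv\<^bsub>BijGroup UNIV\<^esub> h = inv_into UNIV h"
      by (simp add: inv_BijGroup restrict_def)
    moreover have "h (inv_into UNIV h t) = t"
      using bij_generators[OF inv] by (simp add: bij_is_surj surj_f_inv_f)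
    ultimately show ?case using gen[OF inv, of "inv_into UNIV h t"] by simp
  next
    case (eng h1 h2)
    then show ?case
      using mult_Gamma_M[of h2 h1] by (simp add: Gamma_M_eq)
  qed
  obtain g where "g \<in> Gamma_M" "t = g initial_solution"
    using assms(1) by (auto simp: initial_orbit_def)
  then show ?thesis using inv[of g initial_solution] init by simp
qed

section \<open>The star Markov equation along the orbit\<close>

text \<open>
  Under the involution, \<open>aa\<^sup>* + bb\<^sup>* + cc\<^sup>* - abc\<close> does not change: with \<open>b' = ac - b\<^sup>*\<close> it becomes
  \<open>aa\<^sup>* + cc\<^sup>* + b'(b'\<^sup>* - a\<^sup>*c\<^sup>*) = aa\<^sup>* + cc\<^sup>* - (ac - b\<^sup>*)b\<close>. A power of \<open>s\<^sub>3\<close> cancels against its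
  star, and the three powers in \<open>mu_map\<close> have product 1.
\<close>

lemma orbit_solution:
  assumes "t \<in> initial_orbit"
  shows "star_markov_solution t"
  using assms
proof (induction rule: orbit_induct)
  case initial
  have "s1 * s3_inv * (s2 * s3_inv * s3) = s1 * s2 * s3_inv"
    by (simp add: mult.assoc mult.left_commute s3_pow_mult)
  then show ?case
    by (simp add: star_markov_solution_def initial_solution_def star_mult star_s1 star_s3_pow
        power3_eq_cube algebra_simps)
next
  case (sgn_map i j t)
  have norm: "(- 1) ^ n * a * star ((- 1) ^ n * a) = a * star a" for n a
    by (cases "even n") (simp_all add: star_uminus)
  have "(- 1) ^ i * a * ((- 1) ^ (i + j) * b) * ((- 1) ^ j * c) = a * b * c" for a b c :: laurent
    by (cases "even i"; cases "even j") simp_all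
  with norm sgn_map show ?case
    by (cases t) (simp only: star_markov_solution_def sgn_map_def prod.case)
next
  case (vieta t)
  then show ?case
    by (cases t) (simp add: star_markov_solution_def vieta_def star_mult star_diff algebra_simps)
next
  case (mu_map i j t)
  have norm: "s3_pow k * a * star (s3_pow k * a) = a * star a" for k a
  proof -
    have "s3_pow k * a * star (s3_pow k * a) = (s3_pow k * s3_pow (- k)) * (a * star a)"
      unfolding star_mult star_s3_pow by (simp only: ac_simps)
    then show ?thesis by (simp add: s3_pow_mult)
  qed
  have "s3_pow i * a * (s3_pow (- i - j) * b) * (s3_pow j * c) =
      (s3_pow i * s3_pow (- i - j) * s3_pow j) * (a * b * c)" for a b c
    by (simp only: ac_simps)
  then have "s3_pow i * a * (s3_pow (- i - j) * b) * (s3_pow j * c) = a * b * c" for a b c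
    by (simp add: s3_pow_mult)
  with norm mu_map show ?case
    by (cases t) (simp only: star_markov_solution_def mu_map_def prod.case)
qed (auto simp: star_markov_solution_def sigma1_def sigma2_def ac_simps)

text \<open>
  Evaluation at \<open>(3, 3, 1)\<close> makes the right-hand side \<open>(3s\<^sub>1s\<^sub>2 - s\<^sub>1\<^sup>3)/s\<^sub>3\<close> vanish.
\<close>

lemma orbit_markov:
  assumes "(a, b, c) \<in> initial_orbit"
  shows "(ev a)\<^sup>2 + (ev b)\<^sup>2 + (ev c)\<^sup>2 - ev a * ev b * ev c = 0"
proof -
  have "ev (1 + 1 + 1) = 3"
    unfolding ev_add using ev_s3_pow[of 0] by simp
  then have ev3: "ev 3 = 3" by simp
  have "a * star a + b * star b + c * star c - a * b * c = (3 * s1 * s2 - s1 ^ 3) * s3_inv"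
    using orbit_solution[OF assms] by (simp add: star_markov_solution_def)
  from arg_cong[OF this, of ev] show ?thesis
    by (simp add: ev_add ev_diff ev_mult ev_star ev_s1 ev_s2 ev_s3_pow ev3 power2_eq_square
        power3_eq_cube)
qed

section \<open>Normal forms of orbit elements\<close>

lemma vieta_initial: "vieta initial_solution = (star s1, s1\<^sup>2 - s2, star s1)"
  by (simp add: vieta_def initial_solution_def star_mult star_s1 star_s3_pow s3_pow_mult
      mult.assoc power2_eq_square)

text \<open>
  The child as an image of its parent under the group. It puts the tree into the orbit, and
  read backwards it shows that the involution takes a child back to its parent.
\<close>

lemma child_eq:
  assumes "principal_at f1 m n"
  shows "(star (mu_poly f1), mu_poly f1 * f2 - s3 ^ weighted_deg 1 1 1 f1 * f3, star f2) =
    mu_map (- int (m + n)) 0 (vieta (sigma2 (star f1, f2, star f3)))"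
  unfolding mu_poly_principal[OF assms]
  by (simp add: weighted_deg_principal[OF assms] s3_pow_power mu_map_def vieta_def sigma2_def
      star_mult star_s3_pow right_diff_distrib mult.assoc add.commute)

definition reverse :: transformation where
  "reverse = sigma1 \<circ> sigma2 \<circ> sigma1"

lemma reverse_eq: "reverse (a, b, c) = (c, b, a)"
  by (simp add: reverse_def sigma1_def sigma2_def)

lemma tree_in_orbit: "tree f1 f2 f3 \<Longrightarrow> (star f1, f2, star f3) \<in> initial_orbit"
proof (induction rule: tree.induct)
  case root
  show ?case using orbit_vieta[OF initial_in_orbit] by (simp add: vieta_initial)
next
  case (child f1 f2 f3)
  from tree_principal[OF child.hyps] obtain m n where f1: "principal_at f1 m n" by blast
  show ?case
    unfolding child_eq[OF f1] by (intro orbit_mu_map orbit_vieta orbit_sigma2 child.IH)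
next
  case (swap f1 f2 f3)
  have "reverse (star f1, f2, star f3) \<in> initial_orbit"
    unfolding reverse_def comp_apply by (intro orbit_sigma1 orbit_sigma2 swap.IH)
  then show ?case by (simp add: reverse_eq)
qed

text \<open>
  Representatives of the orbit modulo signs, powers of \<open>s\<^sub>3\<close> and permutations: the vertices of the
  Markov tree including the initial vertex \<open>(3, 3, 3)\<close>.
\<close>

inductive_set stems :: "(laurent \<times> laurent \<times> laurent) set" where
  "initial_solution \<in> stems"
| "tree f1 f2 f3 \<Longrightarrow> (star f1, f2, star f3) \<in> stems"

lemma reverse_stems: "t \<in> stems \<Longrightarrow> reverse t \<in> stems"
proof (erule stems.cases)
  assume "t = initial_solution"
  then have "reverse t = initial_solution" by (simp add: reverse_eq initial_solution_def)
  then show ?thesis by (simp add: stems.intros)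
next
  fix f1 f2 f3 assume t: "t = (star f1, f2, star f3)" and tree: "tree f1 f2 f3"
  show ?thesis unfolding t reverse_eq by (rule stems.intros(2)[OF tree.swap[OF tree]])
qed

text \<open>
  Three permutations suffice instead of six because the representatives are closed under reversal;
  they determine the position of the middle entry.
\<close>

definition normal_form :: "laurent \<times> laurent \<times> laurent \<Rightarrow> bool" where
  "normal_form t \<longleftrightarrow> (\<exists>u \<in> stems. \<exists>p \<in> {id, sigma1, sigma2}. \<exists>i j k l.
    t = sgn_map i j (mu_map k l (p u)))"

lemma normal_formI:
  assumes "u \<in> stems" "p = id \<or> p = sigma1 \<or> p = sigma2"
  shows "normal_form (p u)"
proof -
  have "p u = sgn_map 0 0 (mu_map 0 0 (p u))" by (simp add: sgn_map_even mu_map_0)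
  with assms show ?thesis unfolding normal_form_def by blast
qed

lemma normal_formE:
  assumes "normal_form t"
  obtains u p i j k l where "u \<in> stems" "p = id \<or> p = sigma1 \<or> p = sigma2"
    "t = sgn_map i j (mu_map k l (p u))"
  using assms unfolding normal_form_def by blast

lemma mu_map_sgn_map: "mu_map k l (sgn_map i j t) = sgn_map i j (mu_map k l t)"
  by (cases t) (simp add: mu_map_def sgn_map_def mult.left_commute)

lemma normal_form_sgn_map: "normal_form t \<Longrightarrow> normal_form (sgn_map i j t)"
  by (erule normal_formE) (simp add: sgn_map_sgn_map, unfold normal_form_def, blast)

lemma normal_form_mu_map: "normal_form t \<Longrightarrow> normal_form (mu_map k l t)"
  by (erule normal_formE) (simp add: mu_map_sgn_map mu_map_mu_map, unfold normal_form_def, blast)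

lemma sigma1_sgn_map: "sigma1 (sgn_map i j t) = sgn_map (i + j) j (sigma1 t)"
  by (cases t; cases "even i"; cases "even j") (simp_all add: sigma1_def sgn_map_def)

lemma sigma2_sgn_map: "sigma2 (sgn_map i j t) = sgn_map i (i + j) (sigma2 t)"
  by (cases t; cases "even i"; cases "even j") (simp_all add: sigma2_def sgn_map_def)

lemma sigma1_mu_map: "sigma1 (mu_map k l t) = mu_map (- k - l) l (sigma1 t)"
  by (cases t) (simp add: sigma1_def mu_map_def)

lemma sigma2_mu_map: "sigma2 (mu_map k l t) = mu_map k (- k - l) (sigma2 t)"
  by (cases t) (simp add: sigma2_def mu_map_def)

lemma vieta_sgn_map: "vieta (sgn_map i j t) = sgn_map i j (vieta t)"
  by (cases t; cases "even i"; cases "even j") (simp_all add: vieta_def sgn_map_def star_uminus)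

lemma vieta_mu_map: "vieta (mu_map k l t) = mu_map (- k) (- l) (vieta t)"
proof (cases t)
  case (fields a b c)
  have "s3_pow k * a * (s3_pow l * c) = s3_pow (k + l) * (a * c)"
    unfolding s3_pow_mult[symmetric] by (simp only: ac_simps)
  with fields show ?thesis
    by (simp add: vieta_def mu_map_def star_mult star_s3_pow right_diff_distrib add.commute)
qed

lemma normal_form_sigma1:
  assumes "normal_form t"
  shows "normal_form (sigma1 t)"
proof -
  obtain u p i j k l where u: "u \<in> stems" and p: "p = id \<or> p = sigma1 \<or> p = sigma2"
    and t: "t = sgn_map i j (mu_map k l (p u))"
    using assms by (rule normal_formE)
  have "sigma1 (sigma2 u) = sigma2 (reverse u)"
    by (cases u) (simp add: reverse_eq sigma1_def sigma2_def)
  then have "normal_form (sigma1 (p u))"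
    using p normal_formI[OF u, of id] normal_formI[OF u, of sigma1]
      normal_formI[OF reverse_stems[OF u], of sigma2] by (auto simp: sigma1_sigma1)
  then show ?thesis
    unfolding t sigma1_sgn_map sigma1_mu_map by (intro normal_form_sgn_map normal_form_mu_map)
qed

lemma normal_form_sigma2:
  assumes "normal_form t"
  shows "normal_form (sigma2 t)"
proof -
  obtain u p i j k l where u: "u \<in> stems" and p: "p = id \<or> p = sigma1 \<or> p = sigma2"
    and t: "t = sgn_map i j (mu_map k l (p u))"
    using assms by (rule normal_formE)
  have "sigma2 (sigma1 u) = sigma1 (reverse u)"
    by (cases u) (simp add: reverse_eq sigma1_def sigma2_def)
  then have "normal_form (sigma2 (p u))"
    using p normal_formI[OF u, of id] normal_formI[OF u, of sigma2]
      normal_formI[OF reverse_stems[OF u], of sigma1] by (auto simp: sigma2_sigma2)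
  then show ?thesis
    unfolding t sigma2_sgn_map sigma2_mu_map by (intro normal_form_sgn_map normal_form_mu_map)
qed

lemma normal_form_reverse: "normal_form t \<Longrightarrow> normal_form (reverse t)"
  unfolding reverse_def comp_apply by (intro normal_form_sigma1 normal_form_sigma2)

lemma vieta_reverse: "vieta (reverse t) = reverse (vieta t)"
  by (cases t) (simp add: reverse_eq vieta_def mult.commute)

text \<open>
  The involution on the middle entry undoes the step that created the vertex. At the root it leads
  back to the initial solution.
\<close>

lemma normal_form_parent: "tree f1 f2 f3 \<Longrightarrow> normal_form (vieta (star f1, f2, star f3))"
proof (induction rule: tree.induct)
  case root
  show ?case
    unfolding vieta_initial[symmetric] vieta_vieta
    using normal_formI[OF stems.intros(1), of id] by simp
next
  case (child f1 f2 f3)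
  from tree_principal[OF child.hyps] obtain m n where f1: "principal_at f1 m n" by blast
  show ?case
    unfolding child_eq[OF f1] vieta_mu_map vieta_vieta
    using normal_formI[OF stems.intros(2)[OF child.hyps], of sigma2]
    by (simp add: normal_form_mu_map)
next
  case (swap f1 f2 f3)
  then show ?case
    using normal_form_reverse[OF swap.IH] by (simp add: reverse_eq flip: vieta_reverse)
qed

text \<open>
  The involution on an outer entry creates a child. All three entries of the initial solution are
  \<open>s\<^sub>1\<close> up to powers of \<open>s\<^sub>3\<close>, so there the outcome is the root again, up to such powers.
\<close>

lemma normal_form_vieta_sigma2:
  assumes "u \<in> stems"
  shows "normal_form (vieta (sigma2 u))"
  using assms
proof (cases rule: stems.cases)
  case 1
  have "vieta (sigma2 u) = mu_map 0 1 (vieta u)"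
  proof -
    have "vieta (sigma2 u) = (star s1, s1 * (s1 * s3_inv) - star s1, star (s1 * s3_inv))"
      unfolding 1 initial_solution_def by (simp add: vieta_def sigma2_def)
    moreover have "s1 * (s1 * s3_inv) - star s1 = s3_inv * (s1\<^sup>2 - s2)"
      by (simp add: star_s1 power2_eq_square algebra_simps)
    moreover have "star (s1 * s3_inv) = s3 * star s1"
      by (simp add: star_mult star_s3_pow mult.commute)
    ultimately show ?thesis unfolding 1 vieta_initial by (simp add: mu_map_def)
  qed
  moreover have "vieta u \<in> stems"
    unfolding 1 vieta_initial by (intro stems.intros tree.root)
  ultimately show ?thesis
    using normal_formI[of "vieta u" id] normal_form_mu_map by simp
next
  case (2 f1 f2 f3)
  from tree_principal[OF 2(2)] obtain m n where f1: "principal_at f1 m n" by blast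
  have "vieta (sigma2 u) = mu_map (int (m + n)) 0
    (star (mu_poly f1), mu_poly f1 * f2 - s3 ^ weighted_deg 1 1 1 f1 * f3, star f2)"
    unfolding child_eq[OF f1] 2 by (simp add: mu_map_mu_map mu_map_0)
  moreover have "normal_form (star (mu_poly f1),
      mu_poly f1 * f2 - s3 ^ weighted_deg 1 1 1 f1 * f3, star f2)"
    using normal_formI[OF stems.intros(2)[OF tree.child[OF 2(2)]], of id] by simp
  ultimately show ?thesis by (simp only: normal_form_mu_map)
qed

lemma normal_form_vieta:
  assumes "normal_form t"
  shows "normal_form (vieta t)"
proof -
  obtain u p i j k l where u: "u \<in> stems" and p: "p = id \<or> p = sigma1 \<or> p = sigma2"
    and t: "t = sgn_map i j (mu_map k l (p u))"
    using assms by (rule normal_formE)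
  have "normal_form (vieta u)"
    using u
  proof (cases rule: stems.cases)
    case 1
    then show ?thesis
      using normal_formI[OF stems.intros(2)[OF tree.root], of id] by (simp add: vieta_initial)
  next
    case 2
    then show ?thesis by (simp add: normal_form_parent)
  qed
  moreover have "normal_form (vieta (sigma1 u))"
  proof -
    have "sigma1 u = reverse (sigma2 (reverse u))"
      by (cases u) (simp add: reverse_eq sigma1_def sigma2_def)
    then show ?thesis
      using normal_form_vieta_sigma2[OF reverse_stems[OF u]]
      by (simp add: vieta_reverse normal_form_reverse)
  qed
  ultimately have "normal_form (vieta (p u))"
    using p normal_form_vieta_sigma2[OF u] by auto
  then show ?thesis
    unfolding t vieta_sgn_map vieta_mu_map by (intro normal_form_sgn_map normal_form_mu_map)
qed

lemma orbit_normal_form: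
  assumes "t \<in> initial_orbit"
  shows "normal_form t"
  using assms
proof (induction rule: orbit_induct)
  case initial
  show ?case using normal_formI[OF stems.intros(1), of id] by simp
qed (simp_all add: normal_form_sgn_map normal_form_sigma1 normal_form_sigma2 normal_form_vieta
  normal_form_mu_map)

text \<open>
  Powers of \<open>s\<^sub>3\<close> evaluate to 1, so the sign of a unit multiple is visible after evaluation.
\<close>

lemma unit_multiple_positive:
  assumes "x = (- 1) ^ i * (s3_pow k * y)" "0 < ev x" "0 < ev y"
  shows "x = s3_pow k * y"
proof (cases "even i")
  case False
  then have "ev x = - ev y"
    using assms(1) by (simp add: ev_uminus ev_mult ev_s3_pow)
  with assms(2,3) show ?thesis by simp
qed (use assms in simp)

text \<open>
  If \<open>k > 0\<close> then \<open>s\<^sub>3\<close> divides \<open>f\<close>; if \<open>k < 0\<close> then it divides \<open>g\<close>.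
\<close>

lemma s3_multiple_reduced:
  assumes "f \<in> polys" "g \<in> polys" "\<not> s3_dvd f" "\<not> s3_dvd g" "f = s3_pow k * g"
  shows "f = g"
proof -
  have le: "k \<le> 0" if "g \<in> polys" "\<not> s3_dvd f" "f = s3_pow k * g" for f g k
  proof (rule ccontr)
    assume "\<not> k \<le> 0"
    have "s3_pow (k - 1) * g \<in> polys"
      unfolding polys_def
    proof (safe)
      fix i j l assume "(i, j, l) \<in> Poly_Mapping.keys (s3_pow (k - 1) * g)"
      then have "(i, j, l - (k - 1)) \<in> Poly_Mapping.keys g"
        by (simp add: in_keys_iff coeff_s3_pow_mult)
      with that(1) have "0 \<le> l - (k - 1)" unfolding polys_def by blast
      with \<open>\<not> k \<le> 0\<close> show "0 \<le> l" by simp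
    qed
    moreover have "f = s3 * (s3_pow (k - 1) * g)"
      using that(3) by (simp add: s3_pow_mult_left)
    ultimately show False using that(2) by (auto simp: s3_dvd_def)
  qed
  have "g = s3_pow (- k) * f" using assms(5) by (simp add: s3_pow_mult_left)
  with le[OF assms(1,4)] have "- k \<le> 0" by blast
  moreover have "k \<le> 0" using le assms by blast
  ultimately show ?thesis using assms(5) by simp
qed

text \<open>
  The normal form has the same absolute values under evaluation. The initial solution would give
  \<open>(3, 3, 3)\<close>, and a permutation that moves the middle entry of a tree element moves the strict
  maximum away from the middle.
\<close>

lemma reduced_presentation_tree:
  assumes orbit: "(star f1, f2, star f3) \<in> initial_orbit"
    and red: "reduced_solution f1 f2 f3"
    and pos: "0 < ev f1" "ev f1 < ev f2" "0 < ev f3" "ev f3 < ev f2" "6 \<le> ev f2"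
  shows "tree f1 f2 f3"
proof -
  obtain u p i j k l where u: "u \<in> stems" and p: "p = id \<or> p = sigma1 \<or> p = sigma2"
    and t: "(star f1, f2, star f3) = sgn_map i j (mu_map k l (p u))"
    using orbit_normal_form[OF orbit] by (rule normal_formE)
  obtain x y z where xyz: "p u = (x, y, z)" by (cases "p u")
  have t': "star f1 = (- 1) ^ i * (s3_pow k * x)" "f2 = (- 1) ^ (i + j) * (s3_pow (- k - l) * y)"
    "star f3 = (- 1) ^ j * (s3_pow l * z)"
    using t unfolding xyz by (simp_all add: sgn_map_def mu_map_def)
  have eqs: "star f1 = s3_pow k * x" "f2 = s3_pow (- k - l) * y" "star f3 = s3_pow l * z"
    if "0 < ev x" "0 < ev y" "0 < ev z"
    using t'[THEN unit_multiple_positive] that pos by (simp_all add: ev_star)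
  have evs: "ev f1 = ev x" "ev f2 = ev y" "ev f3 = ev z"
    if "0 < ev x" "0 < ev y" "0 < ev z"
    using eqs[OF that, THEN arg_cong, of ev] by (simp_all add: ev_mult ev_s3_pow ev_star)
  from u show ?thesis
  proof (cases rule: stems.cases)
    case 1
    with p xyz have "ev x = 3" "ev y = 3" "ev z = 3"
      by (auto simp: initial_solution_def sigma1_def sigma2_def ev_s1 ev_s3_pow ev_mult)
    with evs pos show ?thesis by simp
  next
    case (2 g1 g2 g3)
    note ev = tree_ev[OF 2(2)]
    have xyz': "x = star g1 \<and> y = g2 \<and> z = star g3 \<or> x = g2 \<and> y = star g1 \<and> z = star g3 \<or>
      x = star g1 \<and> y = star g3 \<and> z = g2"
      using p xyz 2 by (auto simp: sigma1_def sigma2_def)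
    then have "0 < ev x" "0 < ev y" "0 < ev z" using ev by (auto simp: ev_star)
    note eqs = eqs[OF this] and evs = evs[OF this]
    from xyz' ev evs pos have xyz: "x = star g1" "y = g2" "z = star g3"
      by (auto simp: ev_star)
    from eqs(1,3)[THEN arg_cong, of star] have eqs': "f1 = s3_pow (- k) * g1" "f3 = s3_pow (- l) * g3"
      by (simp_all add: xyz star_mult star_s3_pow)
    from tree_principal[OF 2(2)] obtain m1 n1 m3 n3 where
      "principal_at g1 m1 n1" "principal_at g3 m3 n3" "principal_at g2 (m1 + m3) (n1 + n3)"
      by blast
    note g = this[THEN principal_in_polys] this[THEN principal_not_s3_dvd]
    have "f1 = g1" "f2 = g2" "f3 = g3"
      using s3_multiple_reduced[of f1 g1] s3_multiple_reduced[of f2 g2] s3_multiple_reduced[of f3 g3]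
        red g eqs' eqs(2) xyz(2) unfolding reduced_solution_def by blast+
    with 2 show ?thesis by simp
  qed
qed

section \<open>Star Markov polynomials and their duals on the tree\<close>

lemma tree_star_markov_poly:
  assumes "tree f1 f2 f3"
  shows "star_markov_poly f2"
proof -
  from tree_principal[OF assms] obtain m1 n1 m3 n3 where
    f: "principal_at f1 m1 n1" "principal_at f3 m3 n3" "principal_at f2 (m1 + m3) (n1 + n3)"
    and pos: "0 < m1 + n1" "0 < m3 + n3" by blast
  note orbit = tree_in_orbit[OF assms] and ev = tree_ev[OF assms]
  have "nonconstant f1" "nonconstant f2" "nonconstant f3"
    using f[THEN principal_nonconstant] pos by auto
  then have "reduced_solution f1 f2 f3"
    unfolding reduced_solution_def
    using orbit_solution[OF orbit] f[THEN principal_in_polys] f[THEN principal_not_s3_dvd]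
    by blast
  then have "reduced_presentation f1 f2 f3 (ev f1, ev f2, ev f3)"
    by (simp add: reduced_presentation_def Ev_def ev_star)
  moreover have "markov_triple (ev f1, ev f2, ev f3)"
    using orbit_markov[OF orbit] ev by (simp add: markov_triple_def ev_star)
  moreover have "0 < ev f1 \<and> ev f1 < ev f2 \<and> 0 < ev f3 \<and> ev f3 < ev f2 \<and> 6 \<le> ev f2"
    using ev by auto
  ultimately show ?thesis
    using orbit unfolding star_markov_poly_def by blast
qed

lemma dual_mu_poly:
  assumes "star_markov_poly f" "principal_at f m n"
  shows "dual_star_markov_poly (mu_poly f)"
  using assms(1) principal_mu_poly[OF assms(2)]
  by (simp add: dual_star_markov_poly_def mu_poly_mu_poly[OF assms(2)] principal_in_polys
      principal_not_s3_dvd)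

text \<open>
  In the child, \<open>\<mu>(f\<^sub>1)\<close> is dual to \<open>f\<^sub>1\<close>, so the two alternatives change places, while \<open>f\<^sub>2\<close> is a
  \<open>*\<close>-Markov polynomial as the middle entry of its parent. At the root, \<open>\<mu>(s\<^sub>1) = s\<^sub>2\<close>; this is why
  \<open>s\<^sub>2\<close> has to be included among the \<open>*\<close>-Markov polynomials.
\<close>

lemma tree_sides:
  assumes "tree f1 f2 f3"
  shows "(star_markov_poly f1 \<or> dual_star_markov_poly f1) \<and>
    (star_markov_poly f3 \<or> dual_star_markov_poly f3)"
  using assms
proof induction
  case root
  have "mu_poly s1 = s2"
    using mu_poly_principal[OF principal_s1] by (simp add: star_s1 s3_pow_mult mult.left_commute)
  then have "dual_star_markov_poly s1"
    using principal_s1 by (auto simp: dual_star_markov_poly_def star_markov_poly_def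
      principal_in_polys principal_not_s3_dvd)
  then show ?case by simp
next
  case (child f1 f2 f3)
  from tree_principal[OF child.hyps] obtain m n where "principal_at f1 m n" by blast
  then show ?case
    using child.IH tree_star_markov_poly[OF child.hyps] dual_mu_poly dual_star_markov_poly_def
    by blast
qed auto

theorem theorem1p2:
  fixes f1 f2 f3 :: laurent and a b c :: int
  assumes "markov_triple (a, b, c)"
    and "0 < a" "a < b" "0 < c" "c < b" "6 \<le> b"
    and "reduced_presentation f1 f2 f3 (a, b, c)"
    and "(star f1, f2, star f3) \<in> initial_orbit"
  shows "(star_markov_poly f1 \<or> dual_star_markov_poly f1) \<and>
    (star_markov_poly f3 \<or> dual_star_markov_poly f3) \<and>
    (\<forall>d1 q1 d2 q2 d3 q3. bidegree f1 = (d1, q1) \<longrightarrow> bidegree f2 = (d2, q2) \<longrightarrow>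
      bidegree f3 = (d3, q3) \<longrightarrow> (d2, q2) = (d1, q1) + (d3, q3))"
proof -
  have "reduced_solution f1 f2 f3" "ev f1 = a" "ev f2 = b" "ev f3 = c"
    using assms(7) by (auto simp: reduced_presentation_def Ev_def ev_star)
  then have tree: "tree f1 f2 f3"
    using assms(2-6,8) by (intro reduced_presentation_tree) auto
  from tree_principal[OF tree] obtain m1 n1 m3 n3 where
    "principal_at f1 m1 n1" "principal_at f3 m3 n3" "principal_at f2 (m1 + m3) (n1 + n3)"
    by blast
  then have "bidegree f1 = (m1 + n1, m1 + 2 * n1)" "bidegree f3 = (m3 + n3, m3 + 2 * n3)"
    "bidegree f2 = (m1 + m3 + (n1 + n3), m1 + m3 + 2 * (n1 + n3))"
    by (simp_all only: bidegree_principal)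
  with tree_sides[OF tree] show ?thesis by simp
qed

end
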